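(* Let $x$ be computable and have a limit algorithm, let $x'$ be computable, and let all sequences in $\textsc{Seq}$ allow delaying. Then every effective map $F:T\to T'$ is strongly effectively sequentially continuous.
   Context: Notation: $P^{(n)}$ ($R^{(n)}$) are the $n$-ary partial (total) computable functions; $\varphi$ a Gödel numbering of $P^{(1)}$; $\langle\cdot,\cdot\rangle$ a computable pairing function. A numbering of a set $S$ is a partial map from $\omega$ onto $S$. Setting: $\mathcal T=(T,\tau)$ is a countable topological $T_0$ space with countable basis $\mathcal B$, $B$ ($n\mapsto B_n$) a total numbering of $\mathcal B$, $x$ a numbering of $T$, and $\prec_B$ a transitive relation on $\omega$ with $m\prec_B n\Rightarrow B_m\subseteq B_n$ such that whenever $z\in B_m\cap B_n$ there is $a$ with $z\in B_a$, $a\prec_B m$, $a\prec_B n$. $\mathcal T'=(T',\tau')$ is a further countable $T_0$ space with countable basis $\mathcal B'$, total numbering $B'$ of $\mathcal B'$ and numbering $x'$ of $T'$. $x$ (resp. $x'$) is computable if there is a c.e. $L$ with $\langle i,n\rangle\in L\iff x_i\in B_n$ for $i\in\mathrm{dom}(x)$ (resp. $x'_i\in B'_n$ for $i\in\mathrm{dom}(x')$). $F:T\to T'$ is effective if some $f\in P^{(1)}$ satisfies $f(i)\in\mathrm{dom}(x')$ and $F(x_i)=x'_{f(i)}$ for all $i\in\mathrm{dom}(x)$. A sequence $(y_a)_a$ in $T$ is computable if $y_a=x_{g(a)}$ for some $g\in R^{(1)}$ with range in $\mathrm{dom}(x)$; any Gödel number of $g$ is an index. Specialization order: $y\le_\tau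 z$ iff every $B_n$ containing $y$ contains $z$. $\mathrm{hl}(B_n)=\bigcap\{B_a:n\prec_B a\}$. A normed computable enumeration of basic open sets is $(B_{f(a)})_a$ with $f\in R^{(1)}$, $f(a+1)\prec_B f(a)$ (index: Gödel number of $f$); it converges to $y$ if $\{B_{f(a)}\}$ is a strong base of $\mathcal N(y)$ (a nonempty subfamily $\mathcal F$ of $\mathcal N(y)$ such that for $B_m,B_n\in\mathcal F$ some $B_a\in\mathcal F$ has $a\prec_B m,n$, and for each $B_m\in\mathcal N(y)$ some $B_a\in\mathcal F$ has $a\prec_B m$). $\mathrm{Lim}_a y_a$ is the set of topological limit points; convergent means nonempty. The space comes with a fixed collection $\textsc{Seq}$ of computable sequences such that: (1) every computable $\le_\tau$-monotonically increasing sequence is in $\textsc{Seq}$; (2) there is $p\in R^{(1)}$ such that for each index $m$ of a normed computable enumeration converging to $y$, $p(m)$ is an index of a sequence in $\textsc{Seq}$ with (a) $x_{\varphi_{p(m)}(a)}\in\mathrm{hl}(B_{\varphi_m(a)})$ for all $a$, (b) if $\mathcal T$ is not $T_1$, then for every basic open $B_n\notin\mathcal N(y)$ only finitely many $a$ have $x_{\varphi_{p(m)}(a)}\in B_n$; (3) if $(y_a)_a\in\textsc{Seq}$ then for every $\bar a$ the sequence equal to $y_a$ for $a<\bar a$ and $y_{\bar a}$ for $a\ge\bar a$ is in $\textsc{Seq}$. A sequence $(y_a)_a\in\textsc{Seq}$ allows delaying if for all $\bar a,k$ the sequence with $y'_a=y_a$ for $a<\bar a$, $y'_a=y_{\bar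 a}$ for $\bar a\le a\le\bar a+k$, $y'_a=y_{a-k+1}$ otherwise, is in $\textsc{Seq}$. $x$ has a limit algorithm if there is $\mathrm{li}\in P^{(1)}$ such that for all indices $m,m'$ of convergent sequences in $\textsc{Seq}$: (i) $\mathrm{li}(m)$ is defined and in $\mathrm{dom}(x)$; (ii) $x_{\mathrm{li}(m)}\in\mathrm{Lim}_a x_{\varphi_m(a)}$; (iii) if $x_{\varphi_m(a)}=x_{\varphi_m(\bar a)}$ for all $a\ge\bar a$, then $x_{\mathrm{li}(m)}=x_{\varphi_m(\bar a)}$; (iv) if $\mathrm{Lim}_a x_{\varphi_m(a)}=\mathrm{Lim}_a x_{\varphi_{m'}(a)}$ then $x_{\mathrm{li}(m)}=x_{\mathrm{li}(m')}$. For a sequence $(z_a)_a$ in $T'$, a uniform convergence module maps each $n$ with $B'_n\cap\mathrm{Lim}_a z_a\neq\emptyset$ to some $N_n$ with $z_c\in B'_n$ for all $c\ge N_n$; $(z_a)_a$ converges computably if $\mathrm{Lim}_a z_a\neq\emptyset$ and it has a uniform convergence module in $P^{(1)}$. $F$ is strongly effectively sequentially continuous if there is $k'\in R^{(1)}$ such that for every index $m$ of a convergent sequence $(y_a)_a$ in $\textsc{Seq}$: $\mathrm{Lim}_a F(y_a)\supseteq F(\mathrm{Lim}_a y_a)$ and $\varphi_{k'(m)}$ is a uniform convergence module of $(F(y_a))_a$ (defined on all $n$ with $B'_n\cap\mathrm{Lim}_aF(y_a)\ne\emptyset$). *)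

theory Defs
  imports "HOL-Analysis.Abstract_Topological_Spaces" "HOL-Analysis.T1_Spaces"
    "HOL-Analysis.Abstract_Limits"
begin

section \<open>Partial recursive functions\<close>

text \<open>
  Kleene's schemes: constant zero, successor, projections, composition, primitive recursion (on
  the first argument) and unbounded minimization (over the first argument).  The terms carry no
  arity; once the number of arguments of a term is fixed, so is that of each of its subterms.
  A term that does not fit the number of its arguments is undefined there, so that no
  functions beyond the partial recursive ones arise.
\<close>

datatype recf =
    Zero
  | Succ
  | Proj nat
  | Comp recf "recf list"
  | Prec recf recf
  | Mu recf

text \<open>
  In the last equation \<open>z\<close> is the least zero, and all values below it have to be defined.
\<close>

fun reval :: "recf \<Rightarrow> nat list \<Rightarrow> nat option" where
  "reval Zero xs = Some 0"
| "reval Succ xs = (case xs of [a] \<Rightarrow> Some (Suc a) | _ \<Rightarrow> None)"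
| "reval (Proj i) xs = (if i < length xs then Some (xs ! i) else None)"
| "reval (Comp f gs) xs =
     (let vs = map (\<lambda>g. reval g xs) gs
      in if None \<in> set vs then None else reval f (map the vs))"
| "reval (Prec f g) xs =
     (case xs of
        [] \<Rightarrow> None
      | n # ys \<Rightarrow> rec_nat (reval f ys) (\<lambda>k r. Option.bind r (\<lambda>v. reval g (k # v # ys))) n)"
| "reval (Mu f) xs =
     (if \<exists>z. reval f (z # xs) = Some 0 \<and> (\<forall>y<z. \<exists>v>0. reval f (y # xs) = Some v)
      then Some (THE z. reval f (z # xs) = Some 0 \<and> (\<forall>y<z. \<exists>v>0. reval f (y # xs) = Some v))
      else None)"

text \<open>The classes \<open>P\<close> and \<open>R\<close> of partial and total computable functions of one and two arguments.\<close>

definition P1 :: "(nat \<rightharpoonup> nat) \<Rightarrow> bool" where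
  "P1 f \<longleftrightarrow> (\<exists>r. \<forall>a. f a = reval r [a])"

definition P2 :: "(nat \<Rightarrow> nat \<rightharpoonup> nat) \<Rightarrow> bool" where
  "P2 f \<longleftrightarrow> (\<exists>r. \<forall>a b. f a b = reval r [a, b])"

definition R1 :: "(nat \<Rightarrow> nat) \<Rightarrow> bool" where
  "R1 f \<longleftrightarrow> P1 (\<lambda>a. Some (f a))"

definition R2 :: "(nat \<Rightarrow> nat \<Rightarrow> nat) \<Rightarrow> bool" where
  "R2 f \<longleftrightarrow> P2 (\<lambda>a b. Some (f a b))"

definition ce :: "nat set \<Rightarrow> bool" where
  "ce L \<longleftrightarrow> (\<exists>f. P1 f \<and> L = dom f)"

text \<open>
  A Goedel numbering is an acceptable numbering: it enumerates the unary partial computable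
  functions, has a computable universal function and satisfies the s-m-n (translation) property.
\<close>

definition goedel_numbering :: "(nat \<Rightarrow> nat \<rightharpoonup> nat) \<Rightarrow> bool" where
  "goedel_numbering \<phi> \<longleftrightarrow>
     range \<phi> = {f. P1 f} \<and> P2 \<phi> \<and>
     (\<forall>g. P2 g \<longrightarrow> (\<exists>s. R1 s \<and> (\<forall>i. \<phi> (s i) = g i)))"

definition goedel_number :: "(nat \<Rightarrow> nat \<rightharpoonup> nat) \<Rightarrow> nat \<Rightarrow> (nat \<Rightarrow> nat) \<Rightarrow> bool" where
  "goedel_number \<phi> m g \<longleftrightarrow> R1 g \<and> \<phi> m = (\<lambda>a. Some (g a))"

text \<open>Surjectivity is not required; the bijective pairings are a special case.\<close>

definition computable_pairing :: "(nat \<Rightarrow> nat \<Rightarrow> nat) \<Rightarrow> bool" where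
  "computable_pairing pr \<longleftrightarrow> R2 pr \<and> inj (\<lambda>(i, n). pr i n)"


section \<open>Numbered spaces\<close>

definition numbering :: "(nat \<rightharpoonup> 'a) \<Rightarrow> 'a set \<Rightarrow> bool" where
  "numbering x S \<longleftrightarrow> ran x = S"

text \<open>The countable basis is \<open>range B\<close>, totally numbered by \<open>B\<close>.\<close>

definition numbered_T0_space :: "'a topology \<Rightarrow> (nat \<Rightarrow> 'a set) \<Rightarrow> (nat \<rightharpoonup> 'a) \<Rightarrow> bool" where
  "numbered_T0_space X B x \<longleftrightarrow>
     t0_space X \<and> countable (topspace X) \<and>
     openin X = arbitrary union_of (\<lambda>U. U \<in> range B) \<and>
     numbering x (topspace X)"

definition strong_inclusion :: "(nat \<Rightarrow> 'a set) \<Rightarrow> (nat \<Rightarrow> nat \<Rightarrow> bool) \<Rightarrow> bool" where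
  "strong_inclusion B prec \<longleftrightarrow>
     transp prec \<and> (\<forall>m n. prec m n \<longrightarrow> B m \<subseteq> B n) \<and>
     (\<forall>m n. \<forall>z \<in> B m \<inter> B n. \<exists>a. z \<in> B a \<and> prec a m \<and> prec a n)"

definition computable_numbering ::
  "(nat \<Rightarrow> nat \<Rightarrow> nat) \<Rightarrow> (nat \<Rightarrow> 'a set) \<Rightarrow> (nat \<rightharpoonup> 'a) \<Rightarrow> bool" where
  "computable_numbering pr B x \<longleftrightarrow>
     (\<exists>L. ce L \<and> (\<forall>i\<in>dom x. \<forall>n. pr i n \<in> L \<longleftrightarrow> the (x i) \<in> B n))"

definition effective_map :: "(nat \<rightharpoonup> 'a) \<Rightarrow> (nat \<rightharpoonup> 'b) \<Rightarrow> ('a \<Rightarrow> 'b) \<Rightarrow> bool" where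
  "effective_map x x' F \<longleftrightarrow>
     (\<exists>f. P1 f \<and>
        (\<forall>i\<in>dom x. \<exists>j. f i = Some j \<and> j \<in> dom x' \<and> F (the (x i)) = the (x' j)))"

definition nbhd_filter :: "(nat \<Rightarrow> 'a set) \<Rightarrow> 'a \<Rightarrow> 'a set set" where
  "nbhd_filter B y = {U \<in> range B. y \<in> U}"

definition spec_le :: "(nat \<Rightarrow> 'a set) \<Rightarrow> 'a \<Rightarrow> 'a \<Rightarrow> bool" where
  "spec_le B y z \<longleftrightarrow> (\<forall>n. y \<in> B n \<longrightarrow> z \<in> B n)"

text \<open>
  As \<open>prec\<close> relates indices, \<open>hl\<close> is a function of the index \<open>n\<close>, not of the set \<open>B n\<close>.
  The intersection of the empty family is the whole space.
\<close>

definition hl :: "'a topology \<Rightarrow> (nat \<Rightarrow> 'a set) \<Rightarrow> (nat \<Rightarrow> nat \<Rightarrow> bool) \<Rightarrow> nat \<Rightarrow> 'a set" where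
  "hl X B prec n = topspace X \<inter> \<Inter> {B a | a. prec n a}"

definition strong_base ::
  "(nat \<Rightarrow> 'a set) \<Rightarrow> (nat \<Rightarrow> nat \<Rightarrow> bool) \<Rightarrow> 'a set set \<Rightarrow> 'a set set \<Rightarrow> bool" where
  "strong_base B prec \<F> \<N> \<longleftrightarrow>
     \<F> \<noteq> {} \<and> \<F> \<subseteq> \<N> \<and>
     (\<forall>m n. B m \<in> \<F> \<longrightarrow> B n \<in> \<F> \<longrightarrow> (\<exists>a. B a \<in> \<F> \<and> prec a m \<and> prec a n)) \<and>
     (\<forall>m. B m \<in> \<N> \<longrightarrow> (\<exists>a. B a \<in> \<F> \<and> prec a m))"

text \<open>\<open>m\<close> is an index of the normed computable enumeration \<open>(B (f a))\<^sub>a\<close>.\<close>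

definition normed_enumeration ::
  "(nat \<Rightarrow> nat \<rightharpoonup> nat) \<Rightarrow> (nat \<Rightarrow> nat \<Rightarrow> bool) \<Rightarrow> nat \<Rightarrow> (nat \<Rightarrow> nat) \<Rightarrow> bool" where
  "normed_enumeration \<phi> prec m f \<longleftrightarrow>
     goedel_number \<phi> m f \<and> (\<forall>a. prec (f (Suc a)) (f a))"

definition enumeration_converges ::
  "(nat \<Rightarrow> 'a set) \<Rightarrow> (nat \<Rightarrow> nat \<Rightarrow> bool) \<Rightarrow> (nat \<Rightarrow> nat) \<Rightarrow> 'a \<Rightarrow> bool" where
  "enumeration_converges B prec f y \<longleftrightarrow>
     strong_base B prec (range (\<lambda>a. B (f a))) (nbhd_filter B y)"


section \<open>Sequences\<close>

definition Lim_set :: "'a topology \<Rightarrow> (nat \<Rightarrow> 'a) \<Rightarrow> 'a set" where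
  "Lim_set X y = {z. limitin X y z sequentially}"

definition computable_seq :: "(nat \<rightharpoonup> 'a) \<Rightarrow> (nat \<Rightarrow> 'a) \<Rightarrow> bool" where
  "computable_seq x y \<longleftrightarrow> (\<exists>g. R1 g \<and> (\<forall>a. x (g a) = Some (y a)))"

definition seq_index ::
  "(nat \<Rightarrow> nat \<rightharpoonup> nat) \<Rightarrow> (nat \<rightharpoonup> 'a) \<Rightarrow> nat \<Rightarrow> (nat \<Rightarrow> 'a) \<Rightarrow> bool" where
  "seq_index \<phi> x m y \<longleftrightarrow> (\<exists>g. goedel_number \<phi> m g \<and> (\<forall>a. x (g a) = Some (y a)))"

text \<open>The requirements on the fixed collection \<open>Seq\<close> of computable sequences.\<close>

definition admissible_Seq ::
  "(nat \<Rightarrow> nat \<rightharpoonup> nat) \<Rightarrow> 'a topology \<Rightarrow> (nat \<Rightarrow> 'a set) \<Rightarrow> (nat \<Rightarrow> nat \<Rightarrow> bool) \<Rightarrow> (nat \<rightharpoonup> 'a) \<Rightarrow>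
     (nat \<Rightarrow> 'a) set \<Rightarrow> bool" where
  "admissible_Seq \<phi> X B prec x Seq \<longleftrightarrow>
     (\<forall>y\<in>Seq. computable_seq x y) \<and>
     (\<forall>y. computable_seq x y \<and> monotone (\<le>) (spec_le B) y \<longrightarrow> y \<in> Seq) \<and>
     (\<exists>p. R1 p \<and>
        (\<forall>m f. \<forall>y\<in>topspace X.
           normed_enumeration \<phi> prec m f \<and> enumeration_converges B prec f y \<longrightarrow>
           (\<exists>s\<in>Seq. seq_index \<phi> x (p m) s \<and>
              (\<forall>a. s a \<in> hl X B prec (f a)) \<and>
              (\<not> t1_space X \<longrightarrow>
                 (\<forall>n. B n \<notin> nbhd_filter B y \<longrightarrow> finite {a. s a \<in> B n}))))) \<and>
     (\<forall>y\<in>Seq. \<forall>a0. (\<lambda>a. if a < a0 then y a else y a0) \<in> Seq)"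

definition allows_delaying :: "(nat \<Rightarrow> 'a) set \<Rightarrow> (nat \<Rightarrow> 'a) \<Rightarrow> bool" where
  "allows_delaying Seq y \<longleftrightarrow>
     (\<forall>a0 k. (\<lambda>a. if a < a0 then y a else if a \<le> a0 + k then y a0 else y (a - k + 1)) \<in> Seq)"

definition convergent_Seq_index ::
  "(nat \<Rightarrow> nat \<rightharpoonup> nat) \<Rightarrow> 'a topology \<Rightarrow> (nat \<rightharpoonup> 'a) \<Rightarrow> (nat \<Rightarrow> 'a) set \<Rightarrow> nat \<Rightarrow> (nat \<Rightarrow> 'a) \<Rightarrow> bool"
where
  "convergent_Seq_index \<phi> X x Seq m y \<longleftrightarrow> seq_index \<phi> x m y \<and> y \<in> Seq \<and> Lim_set X y \<noteq> {}"

definition limit_algorithm ::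
  "(nat \<Rightarrow> nat \<rightharpoonup> nat) \<Rightarrow> 'a topology \<Rightarrow> (nat \<rightharpoonup> 'a) \<Rightarrow> (nat \<Rightarrow> 'a) set \<Rightarrow> (nat \<rightharpoonup> nat) \<Rightarrow> bool" where
  "limit_algorithm \<phi> X x Seq li \<longleftrightarrow>
     P1 li \<and>
     (\<forall>m y m' y'. convergent_Seq_index \<phi> X x Seq m y \<and> convergent_Seq_index \<phi> X x Seq m' y' \<longrightarrow>
        (\<exists>i. li m = Some i \<and> i \<in> dom x) \<and>
        the (x (the (li m))) \<in> Lim_set X y \<and>
        (\<forall>a0. (\<forall>a\<ge>a0. y a = y a0) \<longrightarrow> the (x (the (li m))) = y a0) \<and>
        (Lim_set X y = Lim_set X y' \<longrightarrow> the (x (the (li m))) = the (x (the (li m')))))"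

definition has_limit_algorithm ::
  "(nat \<Rightarrow> nat \<rightharpoonup> nat) \<Rightarrow> 'a topology \<Rightarrow> (nat \<rightharpoonup> 'a) \<Rightarrow> (nat \<Rightarrow> 'a) set \<Rightarrow> bool" where
  "has_limit_algorithm \<phi> X x Seq \<longleftrightarrow> (\<exists>li. limit_algorithm \<phi> X x Seq li)"

definition uniform_convergence_module ::
  "'a topology \<Rightarrow> (nat \<Rightarrow> 'a set) \<Rightarrow> (nat \<Rightarrow> 'a) \<Rightarrow> (nat \<rightharpoonup> nat) \<Rightarrow> bool" where
  "uniform_convergence_module X B z k \<longleftrightarrow>
     (\<forall>n. B n \<inter> Lim_set X z \<noteq> {} \<longrightarrow> (\<exists>N. k n = Some N \<and> (\<forall>c\<ge>N. z c \<in> B n)))"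

definition strongly_eff_seq_continuous ::
  "(nat \<Rightarrow> nat \<rightharpoonup> nat) \<Rightarrow> 'a topology \<Rightarrow> (nat \<rightharpoonup> 'a) \<Rightarrow> (nat \<Rightarrow> 'a) set \<Rightarrow>
     'b topology \<Rightarrow> (nat \<Rightarrow> 'b set) \<Rightarrow> ('a \<Rightarrow> 'b) \<Rightarrow> bool" where
  "strongly_eff_seq_continuous \<phi> X x Seq X' B' F \<longleftrightarrow>
     (\<exists>k'. R1 k' \<and>
        (\<forall>m y. convergent_Seq_index \<phi> X x Seq m y \<longrightarrow>
           F ` Lim_set X y \<subseteq> Lim_set X' (\<lambda>a. F (y a)) \<and>
           uniform_convergence_module X' B' (\<lambda>a. F (y a)) (\<phi> (k' m))))"

end

theory Submission
  imports Defs "HOL-Library.Nat_Bijection"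
begin

text \<open>
  Let \<open>z = x\<^bsub>li(m)\<^esub>\<close> for an index \<open>m\<close> of a convergent \<open>y \<in> Seq\<close>, and let \<open>W\<close> be a set for which
  \<open>x\<^sub>i \<in> W\<close> is semidecidable, such as \<open>B n\<close> or \<open>F -` B' n\<close>.

  Delaying: by the recursion theorem some \<open>e\<close> follows \<open>y\<close> up to the place \<open>a\<^sub>0\<close> and stays there until
  \<open>x\<^bsub>li(e)\<^esub> \<in> W\<close> is observed, and only then goes on along \<open>y\<close>.  If \<open>y\<^bsub>a\<^sub>0\<^esub> \<in> W\<close>, this has to happen, as
  otherwise the sequence would be eventually constant with limit \<open>y\<^bsub>a\<^sub>0\<^esub>\<close>; as \<open>e\<close> then has the same limits
  as \<open>y\<close>, \<open>z = x\<^bsub>li(e)\<^esub> \<in> W\<close>.  Applied to truncations of \<open>y\<close>, this shows that \<open>y\<^sub>a \<in> W\<close> implies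
  \<open>y\<^sub>c \<in> W\<close> for all \<open>c \<ge> a\<close>.  For \<open>W = B n\<close> it shows that every limit \<open>w\<close> of \<open>y\<close> lies below \<open>z\<close>, and for
  the sequence \<open>w, z, z, \<dots>\<close> that \<open>w \<in> W\<close> implies \<open>z \<in> W\<close>.

  Freezing: another \<open>e\<close>, computable from \<open>m\<close> and \<open>n\<close>, follows \<open>y\<close> until it observes \<open>x\<^bsub>li(e)\<^esub> \<in> W\<^sub>n\<close>, and
  stops there.  If \<open>z \<in> W\<^sub>n\<close>, this happens at some stage \<open>t\<close>, with \<open>y\<^sub>t = x\<^bsub>li(e)\<^esub> \<in> W\<^sub>n\<close>, so \<open>t\<close> is a value of
  the convergence module.
\<close>

section \<open>Closure properties of the partial recursive functions\<close>

text \<open>Terms carry no arity, so agreement is asked only on lists of length \<open>n\<close>.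
  Taking the whole argument list lets the closure rules be chained by \<open>intro\<close>.\<close>

definition precursive :: "nat \<Rightarrow> (nat list \<Rightarrow> nat option) \<Rightarrow> bool" where
  "precursive n F \<longleftrightarrow> (\<exists>r. \<forall>xs. length xs = n \<longrightarrow> reval r xs = F xs)"

abbreviation recursive :: "nat \<Rightarrow> (nat list \<Rightarrow> nat) \<Rightarrow> bool" where
  "recursive n f \<equiv> precursive n (\<lambda>xs. Some (f xs))"

lemma precursive_cong:
  assumes "precursive n F" "\<And>xs. length xs = n \<Longrightarrow> F xs = G xs"
  shows "precursive n G"
  using assms unfolding precursive_def by metis

lemma P1_iff_precursive: "P1 f \<longleftrightarrow> precursive 1 (\<lambda>xs. f (xs ! 0))"
proof -
  have "(\<forall>a. f a = reval r [a]) \<longleftrightarrow> (\<forall>xs. length xs = 1 \<longrightarrow> reval r xs = f (xs ! 0))" for r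
    by (force simp: length_Suc_conv)
  then show ?thesis
    by (simp add: P1_def precursive_def)
qed

lemma P2_iff_precursive: "P2 f \<longleftrightarrow> precursive 2 (\<lambda>xs. f (xs ! 0) (xs ! 1))"
proof -
  have "(\<forall>a b. f a b = reval r [a, b])
      \<longleftrightarrow> (\<forall>xs. length xs = 2 \<longrightarrow> reval r xs = f (xs ! 0) (xs ! 1))" for r
    by (force simp: length_Suc_conv numeral_2_eq_2)
  then show ?thesis
    by (simp add: P2_def precursive_def)
qed

lemma precursive_compose_partial:
  assumes "precursive (length Gs) F" "\<And>G. G \<in> set Gs \<Longrightarrow> precursive n G"
  shows "precursive n (\<lambda>xs. if \<exists>G\<in>set Gs. G xs = None then None
                            else F (map (\<lambda>G. the (G xs)) Gs))"
proof -
  obtain r where r: "\<And>xs. length xs = length Gs \<Longrightarrow> reval r xs = F xs"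
    using assms(1) unfolding precursive_def by blast
  have "\<forall>G\<in>set Gs. \<exists>s. \<forall>xs. length xs = n \<longrightarrow> reval s xs = G xs"
    using assms(2) unfolding precursive_def by blast
  from bchoice[OF this] obtain s
    where s: "\<And>G xs. G \<in> set Gs \<Longrightarrow> length xs = n \<Longrightarrow> reval (s G) xs = G xs"
    by blast
  have "reval (Comp r (map s Gs)) xs
      = (if \<exists>G\<in>set Gs. G xs = None then None else F (map (\<lambda>G. the (G xs)) Gs))"
    if "length xs = n" for xs
  proof -
    have vs: "map (\<lambda>g. reval g xs) (map s Gs) = map (\<lambda>G. G xs) Gs"
      using s[OF _ that] by simp
    have ex: "None \<in> set (map (\<lambda>G. G xs) Gs) \<longleftrightarrow> (\<exists>G\<in>set Gs. G xs = None)"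
      unfolding set_map image_iff by metis
    have the: "map the (map (\<lambda>G. G xs) Gs) = map (\<lambda>G. the (G xs)) Gs"
      by simp
    show ?thesis
      unfolding reval.simps Let_def vs ex the by (rule if_cong) (simp_all add: r)
  qed
  then show ?thesis
    unfolding precursive_def by blast
qed

lemma precursive_compose:
  assumes "precursive (length gs) F" "\<And>g. g \<in> set gs \<Longrightarrow> recursive n g"
  shows "precursive n (\<lambda>xs. F (map (\<lambda>g. g xs) gs))"
proof -
  have "precursive (length (map (\<lambda>g xs. Some (g xs)) gs)) F"
    using assms(1) by simp
  from precursive_compose_partial[OF this, of n] assms(2) show ?thesis
    by (auto simp: comp_def)
qed

lemma recursive_nth: "i < n \<Longrightarrow> recursive n (\<lambda>xs. xs ! i)"
  unfolding precursive_def by (rule exI[of _ "Proj i"]) simp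

lemma map_nth_conv: "length xs = n \<Longrightarrow> map ((!) xs) [0..<n] = xs"
  using map_nth by blast

text \<open>\<open>K\<close> is composed with \<open>G\<close> and all projections. Projections
  never fail, so only an undefined \<open>G\<close> blocks the evaluation of
  \<open>K\<close>.\<close>

lemma precursive_bind:
  assumes G: "precursive n G" and K: "precursive (Suc n) (\<lambda>ys. K (ys ! 0) (tl ys))"
  shows "precursive n (\<lambda>xs. Option.bind (G xs) (\<lambda>v. K v xs))"
proof -
  let ?ps = "map (\<lambda>i xs. Some (xs ! i)) [0..<n]"
  have "precursive (length (G # ?ps)) (\<lambda>ys. K (ys ! 0) (tl ys))"
    using K by simp
  moreover have "precursive n H" if "H \<in> set (G # ?ps)" for H
    using that G by (auto simp: recursive_nth)
  ultimately have "precursive n (\<lambda>xs. if \<exists>H\<in>set (G # ?ps). H xs = None then None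
      else K (map (\<lambda>H. the (H xs)) (G # ?ps) ! 0) (tl (map (\<lambda>H. the (H xs)) (G # ?ps))))"
    by (rule precursive_compose_partial)
  then show ?thesis
  proof (rule precursive_cong)
    fix xs :: "nat list" assume n: "length xs = n"
    have ex: "(\<exists>H\<in>set (G # ?ps). H xs = None) \<longleftrightarrow> G xs = None"
      by auto
    have "map (\<lambda>H. the (H xs)) (G # ?ps) = the (G xs) # xs"
      by (simp add: comp_def map_nth_conv n)
    then show "(if \<exists>H\<in>set (G # ?ps). H xs = None then None
        else K (map (\<lambda>H. the (H xs)) (G # ?ps) ! 0) (tl (map (\<lambda>H. the (H xs)) (G # ?ps))))
      = Option.bind (G xs) (\<lambda>v. K v xs)"
      unfolding ex by (cases "G xs") simp_all
  qed
qed

lemma recursive_Suc: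
  assumes "recursive n f"
  shows "recursive n (\<lambda>xs. Suc (f xs))"
proof -
  have "precursive (length [f]) (\<lambda>xs. Some (Suc (xs ! 0)))"
    unfolding precursive_def by (rule exI[of _ Succ]) (auto simp: length_Suc_conv)
  from precursive_compose[OF this, of n] assms show ?thesis
    by simp
qed

lemma recursive_const: "recursive n (\<lambda>_. c)"
proof (induction c)
  case 0
  then show ?case
    unfolding precursive_def by (intro exI[of _ Zero]) simp
qed (rule recursive_Suc)

text \<open>The last \<open>n\<close> arguments are selected by projections. This moves a function
  under the arguments that recursion and minimization put in front.\<close>

lemma precursive_drop:
  assumes "precursive n F"
  shows "precursive (k + n) (\<lambda>ys. F (drop k ys))"
proof -
  let ?ps = "map (\<lambda>i xs. xs ! i) [k..<k + n]"
  have "precursive (length ?ps) F"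
    using assms by simp
  then have "precursive (k + n) (\<lambda>xs. F (map (\<lambda>g. g xs) ?ps))"
    by (rule precursive_compose) (auto simp: recursive_nth)
  then show ?thesis
    by (rule precursive_cong) (auto intro!: arg_cong[of _ _ F] nth_equalityI)
qed

lemma recursive_rec_nat:
  assumes f: "recursive n f" and c: "recursive n c"
    and g: "recursive (Suc (Suc n)) (\<lambda>ys. g (ys ! 0) (ys ! 1) (drop 2 ys))"
  shows "recursive n (\<lambda>xs. rec_nat (f xs) (\<lambda>k r. g k r xs) (c xs))"
proof -
  obtain rf where rf: "\<And>xs. length xs = n \<Longrightarrow> reval rf xs = Some (f xs)"
    using f unfolding precursive_def by blast
  obtain rg where rg: "\<And>ys. length ys = Suc (Suc n) \<Longrightarrow>
      reval rg ys = Some (g (ys ! 0) (ys ! 1) (drop 2 ys))"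
    using g unfolding precursive_def by blast
  have rec: "rec_nat (reval rf xs) (\<lambda>k r. Option.bind r (\<lambda>v. reval rg (k # v # xs))) m
      = Some (rec_nat (f xs) (\<lambda>k r. g k r xs) m)" if "length xs = n" for m xs
    by (induction m) (use that rf rg in simp_all)
  let ?R = "\<lambda>ys. Some (rec_nat (f (tl ys)) (\<lambda>k r. g k r (tl ys)) (ys ! 0))"
  let ?ps = "c # map (\<lambda>i xs. xs ! i) [0..<n]"
  have "precursive (length ?ps) ?R"
    unfolding precursive_def by (rule exI[of _ "Prec rf rg"]) (auto simp: length_Suc_conv rec)
  then have "precursive n (\<lambda>xs. ?R (map (\<lambda>h. h xs) ?ps))"
    by (rule precursive_compose) (use c in \<open>auto simp: recursive_nth\<close>)
  then show ?thesis
    by (rule precursive_cong) (simp add: comp_def map_nth_conv)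
qed

lemma precursive_Least:
  assumes "recursive (Suc n) (\<lambda>ys. p (ys ! 0) (tl ys))"
  shows "precursive n (\<lambda>xs. if \<exists>z. p z xs = 0 then Some (LEAST z. p z xs = 0) else None)"
proof -
  obtain r where r: "\<And>ys. length ys = Suc n \<Longrightarrow> reval r ys = Some (p (ys ! 0) (tl ys))"
    using assms unfolding precursive_def by blast
  have "reval (Mu r) xs = (if \<exists>z. p z xs = 0 then Some (LEAST z. p z xs = 0) else None)"
    if n: "length xs = n" for xs
  proof -
    have r': "reval r (z # xs) = Some (p z xs)" for z
      using r n by simp
    \<comment> \<open>As \<open>p\<close> is total, the condition of \<open>Mu\<close> on smaller
      values is just minimality of \<open>z\<close>.\<close>
    have eq: "(reval r (z # xs) = Some 0 \<and> (\<forall>y<z. \<exists>v>0. reval r (y # xs) = Some v))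
        \<longleftrightarrow> p z xs = 0 \<and> (\<forall>y. p y xs = 0 \<longrightarrow> z \<le> y)" for z
      by (auto simp: r' not_less[symmetric])
    have "(\<exists>z. p z xs = 0 \<and> (\<forall>y. p y xs = 0 \<longrightarrow> z \<le> y)) \<longleftrightarrow> (\<exists>z. p z xs = 0)"
      using LeastI_ex[of "\<lambda>z. p z xs = 0"] Least_le[of "\<lambda>z. p z xs = 0"] by blast
    then show ?thesis
      unfolding reval.simps eq Least_def by simp
  qed
  then show ?thesis
    unfolding precursive_def by blast
qed

lemma recursive_Least:
  assumes "recursive (Suc n) (\<lambda>ys. p (ys ! 0) (tl ys))" "\<And>xs. \<exists>z. p z xs = 0"
  shows "recursive n (\<lambda>xs. LEAST z. p z xs = 0)"
  using precursive_Least[OF assms(1)] assms(2) by simp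

lemma precursive_P1: "P1 F \<Longrightarrow> recursive n f \<Longrightarrow> precursive n (\<lambda>xs. F (f xs))"
  using precursive_compose[of "[f]" "\<lambda>xs. F (xs ! 0)" n] by (simp add: P1_iff_precursive)

lemma precursive_P2:
  "P2 F \<Longrightarrow> recursive n f \<Longrightarrow> recursive n g \<Longrightarrow> precursive n (\<lambda>xs. F (f xs) (g xs))"
  using precursive_compose[of "[f, g]" "\<lambda>xs. F (xs ! 0) (xs ! 1)" n]
  by (auto simp: P2_iff_precursive numeral_2_eq_2)

lemma recursive_R1: "R1 h \<Longrightarrow> recursive n f \<Longrightarrow> recursive n (\<lambda>xs. h (f xs))"
  unfolding R1_def by (rule precursive_P1)

lemma recursive_R2:
  "R2 h \<Longrightarrow> recursive n f \<Longrightarrow> recursive n g \<Longrightarrow> recursive n (\<lambda>xs. h (f xs) (g xs))"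
  unfolding R2_def by (rule precursive_P2)

section \<open>Arithmetic, case distinctions and pairing\<close>

lemma recursive_pred:
  assumes "recursive n f"
  shows "recursive n (\<lambda>xs. f xs - 1)"
proof -
  have "recursive n (\<lambda>xs. rec_nat 0 (\<lambda>k _. k) (f xs))"
    by (intro recursive_rec_nat recursive_const assms recursive_nth) simp
  moreover have "rec_nat 0 (\<lambda>k _. k) m = m - 1" for m
    by (cases m) auto
  ultimately show ?thesis
    by simp
qed

lemma recursive_drop_2: "recursive n f \<Longrightarrow> recursive (Suc (Suc n)) (\<lambda>ys. f (drop 2 ys))"
  using precursive_drop[of n "\<lambda>xs. Some (f xs)" 2] by simp

lemma recursive_tl: "recursive n f \<Longrightarrow> recursive (Suc n) (\<lambda>ys. f (tl ys))"
  using precursive_drop[of n "\<lambda>xs. Some (f xs)" 1] by (simp add: drop_Suc)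

lemma recursive_if:
  assumes "recursive n c" "recursive n f" "recursive n g"
  shows "recursive n (\<lambda>xs. if c xs = 0 then f xs else g xs)"
proof -
  have "recursive n (\<lambda>xs. rec_nat (f xs) (\<lambda>_ _. g xs) (c xs))"
    by (intro recursive_rec_nat assms recursive_drop_2)
  moreover have "rec_nat u (\<lambda>_ _. v) m = (if m = 0 then u else v)" for u v m :: nat
    by (cases m) auto
  ultimately show ?thesis
    by simp
qed

lemma recursive_add:
  assumes "recursive n f" "recursive n g"
  shows "recursive n (\<lambda>xs. f xs + g xs)"
proof -
  have "recursive n (\<lambda>xs. rec_nat (f xs) (\<lambda>_ r. Suc r) (g xs))"
    by (intro recursive_rec_nat assms recursive_Suc recursive_nth) simp
  moreover have "rec_nat u (\<lambda>_ r. Suc r) m = u + m" for u m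
    by (induction m) auto
  ultimately show ?thesis
    by simp
qed

lemma recursive_diff:
  assumes "recursive n f" "recursive n g"
  shows "recursive n (\<lambda>xs. f xs - g xs)"
proof -
  have "recursive n (\<lambda>xs. rec_nat (f xs) (\<lambda>_ r. r - 1) (g xs))"
    by (intro recursive_rec_nat assms recursive_pred recursive_nth) simp
  moreover have "rec_nat u (\<lambda>_ r. r - 1) m = u - m" for u m :: nat
    by (induction m) auto
  ultimately show ?thesis
    by simp
qed

lemma recursive_if_less:
  assumes "recursive n a" "recursive n b" "recursive n f" "recursive n g"
  shows "recursive n (\<lambda>xs. if a xs < b xs then f xs else g xs)"
proof -
  have "recursive n (\<lambda>xs. if b xs - a xs = 0 then g xs else f xs)"
    by (intro recursive_if recursive_diff assms)
  then show ?thesis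
    by (rule precursive_cong) auto
qed

lemma recursive_min:
  assumes "recursive n f" "recursive n g"
  shows "recursive n (\<lambda>xs. min (f xs) (g xs))"
proof -
  have "recursive n (\<lambda>xs. if f xs < g xs then f xs else g xs)"
    by (intro recursive_if_less assms)
  then show ?thesis
    by (rule precursive_cong) auto
qed

lemma recursive_triangle:
  assumes "recursive n f"
  shows "recursive n (\<lambda>xs. triangle (f xs))"
proof -
  have "recursive n (\<lambda>xs. rec_nat 0 (\<lambda>k r. r + Suc k) (f xs))"
    by (intro recursive_rec_nat recursive_const assms recursive_add recursive_Suc recursive_nth) simp_all
  moreover have "rec_nat 0 (\<lambda>k r. r + Suc k) m = triangle m" for m
    by (induction m) auto
  ultimately show ?thesis
    by simp
qed

lemma recursive_prod_encode:
  "recursive n f \<Longrightarrow> recursive n g \<Longrightarrow> recursive n (\<lambda>xs. prod_encode (f xs, g xs))"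
  unfolding prod_encode_def by (simp add: recursive_add recursive_triangle)

text \<open>The code \<open>triangle (a + b) + a\<close> lies on diagonal \<open>a + b\<close>,
  which is the least \<open>w\<close> such that the next diagonal starts beyond the code.\<close>

lemma Least_triangle: "(LEAST w. Suc (prod_encode (a, b)) - triangle (Suc w) = 0) = a + b"
proof (rule Least_equality)
  fix w assume w: "Suc (prod_encode (a, b)) - triangle (Suc w) = 0"
  show "a + b \<le> w"
  proof (rule ccontr)
    assume "\<not> a + b \<le> w"
    then have "Suc w \<le> a + b" by simp
    have "mono triangle" unfolding mono_iff_le_Suc by simp
    with \<open>Suc w \<le> a + b\<close> have "triangle (Suc w) \<le> triangle (a + b)"
      by (rule monoD[rotated])
    with w show False
      by (simp add: prod_encode_def)
  qed
qed (simp add: prod_encode_def)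

lemma recursive_prod_decode:
  assumes "recursive n f"
  shows "recursive n (\<lambda>xs. fst (prod_decode (f xs)))" "recursive n (\<lambda>xs. snd (prod_decode (f xs)))"
proof -
  define w where "w c = (LEAST w. Suc c - triangle (Suc w) = 0)" for c
  have w: "w (prod_encode (a, b)) = a + b" for a b
    unfolding w_def by (rule Least_triangle)
  have fst: "fst (prod_decode c) = c - triangle (w c)" for c
  proof -
    have "prod_encode (prod_decode c) = c" by simp
    then have "triangle (w c) + fst (prod_decode c) = c"
      using w[of "fst (prod_decode c)" "snd (prod_decode c)"] by (simp add: prod_encode_def case_prod_beta)
    then show ?thesis by linarith
  qed
  have snd: "snd (prod_decode c) = w c - fst (prod_decode c)" for c
    using w[of "fst (prod_decode c)" "snd (prod_decode c)"] by simp
  have "\<exists>z. Suc c - triangle (Suc z) = 0" for c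
    by (rule exI[of _ c]) simp
  then have "recursive n (\<lambda>xs. w (f xs))"
    unfolding w_def
    by (intro recursive_Least recursive_diff recursive_triangle recursive_Suc recursive_nth
        recursive_tl assms) simp_all
  then show "recursive n (\<lambda>xs. fst (prod_decode (f xs)))"
    unfolding fst by (intro recursive_diff recursive_triangle assms)
  then show "recursive n (\<lambda>xs. snd (prod_decode (f xs)))"
    unfolding snd using \<open>recursive n (\<lambda>xs. w (f xs))\<close> by (intro recursive_diff)
qed

section \<open>Computations with bounded search\<close>

text \<open>
  The value \<open>0\<close> of \<open>feval r k xs\<close> stands for "undefined", and \<open>Suc v\<close> for the value \<open>v\<close>.  Only
  minimizations are bounded by \<open>k\<close>; this makes \<open>feval r\<close> recursive in \<open>k\<close> and \<open>xs\<close>.  The state of the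
  loop for \<open>Mu\<close> is \<open>0\<close> while it searches, \<open>1\<close> after it met an undefined value, and \<open>z + 2\<close> once \<open>z\<close>
  is found.
\<close>

primrec feval :: "recf \<Rightarrow> nat \<Rightarrow> nat list \<Rightarrow> nat" where
  "feval Zero k xs = 1"
| "feval Succ k xs = (case xs of [a] \<Rightarrow> Suc (Suc a) | _ \<Rightarrow> 0)"
| "feval (Proj i) k xs = (if i < length xs then Suc (xs ! i) else 0)"
| "feval (Comp f gs) k xs =
     (if prod_list (map (\<lambda>g. feval g k xs) gs) = 0 then 0
      else feval f k (map (\<lambda>g. feval g k xs - 1) gs))"
| "feval (Prec f g) k xs =
     (case xs of
        [] \<Rightarrow> 0
      | n # ys \<Rightarrow> rec_nat (feval f k ys) (\<lambda>i r. if r = 0 then 0 else feval g k (i # (r - 1) # ys)) n)"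
| "feval (Mu f) k xs =
     rec_nat 0 (\<lambda>z r. if r = 0 then (if feval f k (z # xs) = 0 then 1
                                    else if feval f k (z # xs) - 1 = 0 then Suc (Suc z) else 0)
                     else r) k - 1"

lemma recursive_mult:
  assumes "recursive n f" "recursive n g"
  shows "recursive n (\<lambda>xs. f xs * g xs)"
proof -
  have "recursive n (\<lambda>xs. rec_nat 0 (\<lambda>_ r. r + f xs) (g xs))"
    by (intro recursive_rec_nat recursive_const assms recursive_add recursive_drop_2 recursive_nth)
      simp
  moreover have "rec_nat 0 (\<lambda>_ r. r + u) m = u * m" for u m
    by (induction m) auto
  ultimately show ?thesis
    by simp
qed

lemma recursive_prod_list:
  "(\<And>g. g \<in> set gs \<Longrightarrow> recursive n (f g)) \<Longrightarrow> recursive n (\<lambda>xs. prod_list (map (\<lambda>g. f g xs) gs))"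
  by (induction gs) (simp_all add: recursive_const recursive_mult)

text \<open>The induction has to vary the argument list, as \<open>Comp\<close> substitutes into it
  and \<open>Prec\<close> and \<open>Mu\<close> prepend to it. Hence the arguments are themselves
  recursive functions.\<close>

lemma recursive_feval:
  assumes "recursive n c" "\<And>g. g \<in> set gs \<Longrightarrow> recursive n g"
  shows "recursive n (\<lambda>xs. feval r (c xs) (map (\<lambda>g. g xs) gs))"
  using assms
proof (induction r arbitrary: n c gs)
  case Zero
  show ?case
    by (simp add: recursive_const)
next
  case Succ
  show ?case
  proof (cases "\<exists>g. gs = [g]")
    case True
    then obtain g where g: "gs = [g]"
      by blast
    with Succ have "recursive n g"
      by simp
    then show ?thesis
      unfolding g by (simp add: recursive_Suc)
  next
    case False
    then have "feval Succ (c xs) (map (\<lambda>g. g xs) gs) = 0" for xs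
      by (auto split: list.split)
    then show ?thesis
      by (simp only: recursive_const)
  qed
next
  case (Proj i)
  show ?case
  proof (cases "i < length gs")
    case True
    with Proj have "recursive n (gs ! i)"
      by simp
    with True show ?thesis
      by (simp add: recursive_Suc)
  qed (simp add: recursive_const)
next
  case (Comp f hs)
  let ?e = "\<lambda>h xs. feval h (c xs) (map (\<lambda>g. g xs) gs)"
  have e: "recursive n (?e h)" if "h \<in> set hs" for h
    using Comp that by blast
  have "recursive n (\<lambda>xs. feval f (c xs) (map (\<lambda>g. g xs) (map (\<lambda>h xs. ?e h xs - 1) hs)))"
  proof (rule Comp.IH(1))
    fix g assume "g \<in> set (map (\<lambda>h xs. ?e h xs - 1) hs)"
    then obtain h where "h \<in> set hs" "g = (\<lambda>xs. ?e h xs - 1)"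
      by auto
    then show "recursive n g"
      using recursive_pred[OF e] by simp
  qed (rule Comp.prems)
  then have "recursive n (\<lambda>xs. feval f (c xs) (map (\<lambda>h. ?e h xs - 1) hs))"
    by (simp add: comp_def)
  then show ?case
    unfolding feval.simps by (intro recursive_if recursive_prod_list recursive_const e)
next
  case (Prec f g)
  show ?case
  proof (cases gs)
    case Nil
    then show ?thesis
      by (simp add: recursive_const)
  next
    case (Cons h hs)
    \<comment> \<open>Arguments of the loop body: the counter, the decoded accumulator, and the
      parameters behind them.\<close>
    let ?hs = "(\<lambda>ys. ys ! 0) # (\<lambda>ys. ys ! 1 - 1) # map (\<lambda>h ys. h (drop 2 ys)) hs"
    have hs: "recursive n h" if "h \<in> set hs" for h
      using Prec.prems(2) Cons that by simp
    have "recursive (Suc (Suc n)) k" if "k \<in> set ?hs" for k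
      using that recursive_pred[OF recursive_nth] recursive_nth recursive_drop_2[OF hs] by auto
    then have "recursive (Suc (Suc n)) (\<lambda>ys. feval g (c (drop 2 ys)) (map (\<lambda>h. h ys) ?hs))"
      by (intro Prec.IH(2) recursive_drop_2 Prec.prems(1))
    then have g: "recursive (Suc (Suc n))
        (\<lambda>ys. feval g (c (drop 2 ys)) (ys ! 0 # (ys ! 1 - 1) # map (\<lambda>h. h (drop 2 ys)) hs))"
      by (simp add: comp_def)
    have "recursive n (\<lambda>xs. rec_nat (feval f (c xs) (map (\<lambda>g. g xs) hs))
        (\<lambda>i r. if r = 0 then 0 else feval g (c xs) (i # (r - 1) # map (\<lambda>g. g xs) hs)) (h xs))"
    proof (rule recursive_rec_nat)
      show "recursive n h"
        by (simp add: Prec.prems(2) Cons)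
      show "recursive n (\<lambda>xs. feval f (c xs) (map (\<lambda>g. g xs) hs))"
        by (intro Prec.IH(1) Prec.prems(1) hs)
      show "recursive (Suc (Suc n)) (\<lambda>ys. if ys ! 1 = 0 then 0 else feval g (c (drop 2 ys))
          (ys ! 0 # (ys ! 1 - 1) # map (\<lambda>g. g (drop 2 ys)) hs))"
        by (intro recursive_if g recursive_const recursive_nth) simp
    qed
    then show ?thesis
      by (simp add: Cons)
  qed
next
  case (Mu f)
  let ?gs = "(\<lambda>ys. ys ! 0) # map (\<lambda>g ys. g (drop 2 ys)) gs"
  have "recursive (Suc (Suc n)) k" if "k \<in> set ?gs" for k
    using that recursive_nth recursive_drop_2[OF Mu.prems(2)] by auto
  then have "recursive (Suc (Suc n)) (\<lambda>ys. feval f (c (drop 2 ys)) (map (\<lambda>g. g ys) ?gs))"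
    by (intro Mu.IH recursive_drop_2 Mu.prems(1))
  then have f: "recursive (Suc (Suc n))
      (\<lambda>ys. feval f (c (drop 2 ys)) (ys ! 0 # map (\<lambda>g. g (drop 2 ys)) gs))"
    by (simp add: comp_def)
  show ?case
    unfolding feval.simps
    by (intro recursive_pred recursive_rec_nat recursive_if f recursive_const recursive_Suc
        recursive_nth Mu.prems) simp_all
qed

lemma reval_if_feval: "feval r k xs = Suc v \<Longrightarrow> reval r xs = Some v"
proof (induction r arbitrary: xs v)
  case (Comp f gs)
  have nz: "feval g k xs \<noteq> 0" if "g \<in> set gs" for g
    using Comp.prems that by (fastforce simp: prod_list_zero_iff split: if_splits)
  have "reval g xs = Some (feval g k xs - 1)" if "g \<in> set gs" for g
    using Comp.IH(2)[OF that, of xs] nz[OF that] by (cases "feval g k xs") auto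
  then have vs: "map (\<lambda>g. reval g xs) gs = map (\<lambda>g. Some (feval g k xs - 1)) gs"
    by simp
  have "feval f k (map (\<lambda>g. feval g k xs - 1) gs) = Suc v"
    using Comp.prems by (simp split: if_splits)
  then have "reval f (map (\<lambda>g. feval g k xs - 1) gs) = Some v"
    by (rule Comp.IH(1))
  then show ?case
    unfolding reval.simps vs by (auto simp: comp_def)
next
  case (Prec f g)
  then obtain n ys where xs: "xs = n # ys"
    by (cases xs) auto
  let ?R = "rec_nat (feval f k ys) (\<lambda>i r. if r = 0 then 0 else feval g k (i # (r - 1) # ys))"
  have "?R n = Suc v \<Longrightarrow> rec_nat (reval f ys) (\<lambda>k r. Option.bind r (\<lambda>v. reval g (k # v # ys))) n = Some v"
    for n v
  proof (induction n arbitrary: v)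
    case 0
    then show ?case
      using Prec.IH(1) by simp
  next
    case (Suc n)
    then obtain w where "?R n = Suc w"
      by (cases "?R n") auto
    with Suc Prec.IH(2) show ?case
      by simp
  qed
  with Prec.prems show ?case
    by (simp add: xs)
next
  case (Mu f)
  let ?S = "rec_nat 0 (\<lambda>z r. if r = 0 then (if feval f k (z # xs) = 0 then 1
        else if feval f k (z # xs) - 1 = 0 then Suc (Suc z) else 0) else r)"
  \<comment> \<open>Loop invariant. A value of \<open>feval\<close> above 1 encodes a positive
    result, and 1 encodes the result zero. About the error state 1 nothing is claimed.\<close>
  have inv: "(?S m = 0 \<longrightarrow> (\<forall>y<m. 1 < feval f k (y # xs)))
      \<and> (\<forall>z. ?S m = Suc (Suc z) \<longrightarrow> feval f k (z # xs) = 1 \<and> (\<forall>y<z. 1 < feval f k (y # xs)))" for m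
    by (induction m) (auto simp: less_Suc_eq split: if_splits)
  have "?S k = Suc (Suc v)"
    using Mu.prems by simp
  with inv have v: "feval f k (v # xs) = Suc 0" "\<And>y. y < v \<Longrightarrow> 1 < feval f k (y # xs)"
    by auto
  have v0: "reval f (v # xs) = Some 0"
    using v(1) by (rule Mu.IH)
  have less: "\<exists>w>0. reval f (y # xs) = Some w" if "y < v" for y
    using Mu.IH[of "y # xs" "feval f k (y # xs) - 1"] v(2)[OF that] by force
  have "(THE z. reval f (z # xs) = Some 0 \<and> (\<forall>y<z. \<exists>v>0. reval f (y # xs) = Some v)) = v"
  proof (rule the_equality)
    fix z assume z: "reval f (z # xs) = Some 0 \<and> (\<forall>y<z. \<exists>v>0. reval f (y # xs) = Some v)"
    show "z = v"
      using z v0 less[of z] by (cases z v rule: linorder_cases) auto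
  qed (use v0 less in auto)
  with v0 less show ?case
    by auto
qed (auto split: list.splits if_splits)

text \<open>Only finitely many subcomputations occur. Speaking of all large bounds lets theirs be
  merged without monotonicity of \<open>feval\<close> in \<open>k\<close>.\<close>

lemma eventually_feval: "reval r xs = Some v \<Longrightarrow> \<forall>\<^sub>F k in sequentially. feval r k xs = Suc v"
proof (induction r arbitrary: xs v)
  case (Comp f gs)
  have nN: "None \<notin> set (map (\<lambda>g. reval g xs) gs)"
    using Comp.prems by (auto simp: Let_def split: if_splits)
  let ?v = "\<lambda>g. the (reval g xs)"
  have g: "reval g xs = Some (?v g)" if "g \<in> set gs" for g
    using nN that by (cases "reval g xs") (auto simp: image_iff)
  have "reval f (map ?v gs) = Some v"
    using Comp.prems nN by (simp add: comp_def)
  then have "\<forall>\<^sub>F k in sequentially. feval f k (map ?v gs) = Suc v"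
    by (rule Comp.IH(1))
  moreover have "\<forall>\<^sub>F k in sequentially. \<forall>g\<in>set gs. feval g k xs = Suc (?v g)"
    by (intro eventually_ball_finite ballI Comp.IH(2) g) auto
  ultimately show ?case
  proof eventually_elim
    case (elim k)
    have vs: "map (\<lambda>g. feval g k xs - 1) gs = map ?v gs"
      using elim(2) by simp
    have nz: "prod_list (map (\<lambda>g. feval g k xs) gs) \<noteq> 0"
      using elim(2) by (auto simp: prod_list_zero_iff)
    show ?case
      unfolding feval.simps vs using elim(1) nz by simp
  qed
next
  case (Prec f g)
  then obtain n ys where xs: "xs = n # ys"
    by (cases xs) auto
  let ?R = "\<lambda>k. rec_nat (feval f k ys) (\<lambda>i r. if r = 0 then 0 else feval g k (i # (r - 1) # ys))"
  let ?Q = "rec_nat (reval f ys) (\<lambda>k r. Option.bind r (\<lambda>v. reval g (k # v # ys)))"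
  have "?Q n = Some v \<Longrightarrow> \<forall>\<^sub>F k in sequentially. ?R k n = Suc v" for n v
  proof (induction n arbitrary: v)
    case 0
    then show ?case
      using Prec.IH(1) by simp
  next
    case (Suc n)
    then obtain w where w: "?Q n = Some w" "reval g (n # w # ys) = Some v"
      by (cases "?Q n") auto
    from Suc.IH[OF w(1)] Prec.IH(2)[OF w(2)] show ?case
      by eventually_elim simp
  qed
  with Prec.prems show ?case
    by (simp add: xs)
next
  case (Mu f)
  define P where "P z \<longleftrightarrow> reval f (z # xs) = Some 0 \<and> (\<forall>y<z. \<exists>v>0. reval f (y # xs) = Some v)" for z
  have "\<exists>z. P z" and v: "v = (THE z. P z)"
    using Mu.prems by (auto simp: P_def split: if_splits)
  moreover have "z = z'" if "P z" "P z'" for z z'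
    using that unfolding P_def by (cases z z' rule: linorder_cases) auto
  ultimately have "P v"
    by (metis theI)
  then have v0: "reval f (v # xs) = Some 0"
    and less: "\<And>y. y < v \<Longrightarrow> \<exists>w. reval f (y # xs) = Some (Suc w)"
    unfolding P_def by (auto simp: gr0_conv_Suc)
  have "\<forall>\<^sub>F k in sequentially. 1 < feval f k (y # xs)" if y: "y < v" for y
  proof -
    obtain w where "reval f (y # xs) = Some (Suc w)"
      using less[OF y] by blast
    from Mu.IH[OF this] show ?thesis
      by eventually_elim simp
  qed
  then have "\<forall>\<^sub>F k in sequentially. \<forall>y\<in>{..<v}. 1 < feval f k (y # xs)"
    by (intro eventually_ball_finite) auto
  then show ?case
    using Mu.IH[OF v0] eventually_gt_at_top[of v]
  proof eventually_elim
    case (elim k)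
    let ?S = "rec_nat 0 (\<lambda>z r. if r = 0 then (if feval f k (z # xs) = 0 then 1
        else if feval f k (z # xs) - 1 = 0 then Suc (Suc z) else 0) else r)"
    have S0: "?S m = 0" if "m \<le> v" for m
      using that
    proof (induction m)
      case (Suc m)
      then have "1 < feval f k (m # xs)"
        using elim(1) by auto
      with Suc show ?case
        by simp
    qed simp
    \<comment> \<open>Once round \<open>v\<close> has found the zero, the remaining \<open>d\<close>
      rounds keep the state.\<close>
    have "?S (Suc v + d) = Suc (Suc v)" for d
      by (induction d) (use S0[of v] elim(2) in simp_all)
    from this[of "k - Suc v"] elim(3) show ?case
      by simp
  qed
qed (auto split: list.splits if_splits)

text \<open>\<open>T a b k\<close> is bounded evaluation with bound \<open>k\<close>, so a
  semidecidable event becomes a total recursive test at stages.\<close>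

lemma P2_stages:
  assumes "P2 G"
  obtains T where "recursive 3 (\<lambda>xs. T (xs ! 0) (xs ! 1) (xs ! 2))"
    and "\<And>a b. (\<exists>k. T a b k \<noteq> 0) \<longleftrightarrow> G a b \<noteq> None"
proof -
  obtain r where r: "\<And>a b. G a b = reval r [a, b]"
    using assms unfolding P2_def by blast
  let ?T = "\<lambda>a b k. feval r k [a, b]"
  have "recursive 3 (\<lambda>xs. feval r (xs ! 2) (map (\<lambda>g. g xs) [\<lambda>xs. xs ! 0, \<lambda>xs. xs ! 1]))"
  proof (rule recursive_feval)
    show "recursive 3 g" if "g \<in> set [\<lambda>xs. xs ! 0, \<lambda>xs. xs ! 1]" for g
      using that recursive_nth[of 0 3] recursive_nth[of 1 3] by auto
  qed (rule recursive_nth, simp)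
  moreover have "(\<exists>k. ?T a b k \<noteq> 0) \<longleftrightarrow> G a b \<noteq> None" for a b
  proof
    assume "\<exists>k. ?T a b k \<noteq> 0"
    then obtain k v where "?T a b k = Suc v"
      by (metis not0_implies_Suc)
    then show "G a b \<noteq> None"
      by (simp add: r reval_if_feval)
  next
    assume "G a b \<noteq> None"
    then obtain v where "reval r [a, b] = Some v"
      by (auto simp: r)
    from eventually_happens[OF eventually_feval[OF this]] show "\<exists>k. ?T a b k \<noteq> 0"
      by (metis nat.distinct(1) trivial_limit_sequentially)
  qed
  ultimately show ?thesis
    by (intro that[of ?T]) simp_all
qed

lemma precursive_compose3:
  assumes "precursive 3 (\<lambda>xs. H (xs ! 0) (xs ! 1) (xs ! 2))"
    and "recursive n f" "recursive n g" "recursive n h"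
  shows "precursive n (\<lambda>xs. H (f xs) (g xs) (h xs))"
proof -
  have "precursive (length [f, g, h]) (\<lambda>xs. H (xs ! 0) (xs ! 1) (xs ! 2))"
    using assms(1) by (simp add: numeral_3_eq_3)
  moreover have "recursive n k" if "k \<in> set [f, g, h]" for k
    using that assms(2-4) by auto
  ultimately have "precursive n (\<lambda>xs. (\<lambda>xs. H (xs ! 0) (xs ! 1) (xs ! 2)) (map (\<lambda>k. k xs) [f, g, h]))"
    by (rule precursive_compose)
  then show ?thesis
    by (simp add: numeral_2_eq_2)
qed

text \<open>A clock that advances with \<open>b\<close> and stops for good at the first stage where
  \<open>T\<close> is nonzero. As a primitive recursion it is total even if there is no such
  stage.\<close>

definition first_stage :: "(nat \<Rightarrow> nat) \<Rightarrow> nat \<Rightarrow> nat" where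
  "first_stage T b = rec_nat 0 (\<lambda>a r. if T r = 0 then Suc a else r) b"

lemma first_stage_eq:
  "first_stage T b = (if \<exists>k. T k \<noteq> 0 then min b (LEAST k. T k \<noteq> 0) else b)"
proof (cases "\<exists>k. T k \<noteq> 0")
  case True
  define l where "l = (LEAST k. T k \<noteq> 0)"
  have l: "T l \<noteq> 0"
    unfolding l_def using True by (rule LeastI_ex)
  have less: "T k = 0" if "k < l" for k
    using not_less_Least[of k "\<lambda>k. T k \<noteq> 0"] that unfolding l_def by blast
  have "first_stage T b = min b l"
  proof (induction b)
    case (Suc b)
    then show ?case
      using l less[of b] by (cases b l rule: linorder_cases) (auto simp: first_stage_def)
  qed (simp add: first_stage_def)
  with True show ?thesis
    by (simp add: l_def)
next
  case False
  then show ?thesis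
    by (induction b) (auto simp: first_stage_def)
qed

lemma recursive_first_stage:
  assumes T: "recursive 3 (\<lambda>xs. T (xs ! 0) (xs ! 1) (xs ! 2))"
    and "recursive n f" "recursive n g" "recursive n h"
  shows "recursive n (\<lambda>xs. first_stage (T (f xs) (g xs)) (h xs))"
  unfolding first_stage_def
  by (intro recursive_rec_nat recursive_const recursive_if recursive_Suc recursive_nth recursive_drop_2
      precursive_compose3[OF T] assms) simp_all

section \<open>The recursion theorem\<close>

lemma R2_iff_recursive: "R2 f \<longleftrightarrow> recursive 2 (\<lambda>xs. f (xs ! 0) (xs ! 1))"
  by (simp add: R2_def P2_iff_precursive)

lemma R1_iff_recursive: "R1 f \<longleftrightarrow> recursive 1 (\<lambda>xs. f (xs ! 0))"
  by (simp add: R1_def P1_iff_precursive)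

text \<open>The translation property handles one parameter, so \<open>p\<close> and \<open>u\<close>
  are paired.\<close>

lemma goedel_numbering_smn:
  assumes "goedel_numbering \<phi>" and H: "precursive 3 (\<lambda>xs. H (xs ! 0) (xs ! 1) (xs ! 2))"
  obtains s where "R2 s" "\<And>p u. \<phi> (s p u) = H p u"
proof -
  let ?G = "\<lambda>c. H (fst (prod_decode c)) (snd (prod_decode c))"
  have "P2 ?G"
    unfolding P2_iff_precursive
    by (intro precursive_compose3[OF H] recursive_prod_decode recursive_nth) simp_all
  then obtain s where s: "R1 s" "\<And>c. \<phi> (s c) = ?G c"
    using assms(1) unfolding goedel_numbering_def by blast
  show ?thesis
  proof
    show "R2 (\<lambda>p u. s (prod_encode (p, u)))"
      unfolding R2_iff_recursive
      by (intro recursive_R1[OF s(1)] recursive_prod_encode recursive_nth) simp_all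
  qed (simp add: s)
qed

text \<open>Kleene's diagonal argument, with the fixed point computable from a parameter, so that a
  program can use its own index and a further input.\<close>

lemma recursion_theorem:
  assumes \<phi>: "goedel_numbering \<phi>" and H: "precursive 3 (\<lambda>xs. H (xs ! 0) (xs ! 1) (xs ! 2))"
  obtains e where "R1 e" "\<And>p. \<phi> (e p) = H p (e p)"
proof -
  have P2: "P2 \<phi>" and range: "range \<phi> = {f. P1 f}"
    using \<phi> by (simp_all add: goedel_numbering_def)
  \<comment> \<open>Self-application: the program \<open>u\<close> is run on the code of
    \<open>(p, u)\<close>, and the resulting index is run on \<open>a\<close>.\<close>
  let ?D = "\<lambda>p u a. Option.bind (\<phi> u (prod_encode (p, u))) (\<lambda>w. \<phi> w a)"
  have "precursive 3 (\<lambda>xs. ?D (xs ! 0) (xs ! 1) (xs ! 2))"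
    by (intro precursive_bind precursive_P2[OF P2] recursive_prod_encode recursive_nth recursive_tl)
      simp_all
  from goedel_numbering_smn[OF \<phi> this]
  obtain s where s: "R2 s" "\<And>p u. \<phi> (s p u) = ?D p u"
    by blast
  have "precursive 3 (\<lambda>xs. H (xs ! 0) (s (xs ! 0) (xs ! 1)) (xs ! 2))"
    by (intro precursive_compose3[OF H] recursive_R2[OF s(1)] recursive_nth) simp_all
  from goedel_numbering_smn[OF \<phi> this]
  obtain d where d: "R2 d" "\<And>p u. \<phi> (d p u) = H p (s p u)"
    by blast
  have "P1 (\<lambda>c. Some (d (fst (prod_decode c)) (snd (prod_decode c))))"
    unfolding P1_iff_precursive
    by (intro recursive_R2[OF d(1)] recursive_prod_decode recursive_nth) simp_all
  then have "(\<lambda>c. Some (d (fst (prod_decode c)) (snd (prod_decode c)))) \<in> range \<phi>"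
    by (simp add: range)
  \<comment> \<open>With \<open>v\<close> an index of \<open>d\<close>, the program
    \<open>s p v\<close> runs \<open>d p v\<close>, which computes
    \<open>H p (s p v)\<close>.\<close>
  then obtain v where v: "\<phi> v = (\<lambda>c. Some (d (fst (prod_decode c)) (snd (prod_decode c))))"
    by (metis rangeE)
  show ?thesis
  proof
    show "R1 (\<lambda>p. s p v)"
      unfolding R1_iff_recursive by (intro recursive_R2[OF s(1)] recursive_nth recursive_const) simp
  qed (simp add: s v d)
qed

section \<open>Limit algorithms and delaying\<close>

text \<open>Uniformity in \<open>n\<close> lets a convergence module take \<open>n\<close> as input.
  Outside \<open>dom x\<close> the behaviour of \<open>G\<close> is left open.\<close>

definition semidecidable_family :: "(nat \<rightharpoonup> 'a) \<Rightarrow> (nat \<Rightarrow> 'a set) \<Rightarrow> bool" where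
  "semidecidable_family x W \<longleftrightarrow>
     (\<exists>G. P2 G \<and> (\<forall>i\<in>dom x. \<forall>n. G i n \<noteq> None \<longleftrightarrow> the (x i) \<in> W n))"

lemma semidecidable_vimage:
  assumes "computable_pairing pr" "computable_numbering pr B' x'" "effective_map x x' F"
  shows "semidecidable_family x (\<lambda>n. F -` B' n)"
proof -
  have pr: "R2 pr"
    using assms(1) by (simp add: computable_pairing_def)
  obtain L where "ce L" and L: "\<And>j n. j \<in> dom x' \<Longrightarrow> pr j n \<in> L \<longleftrightarrow> the (x' j) \<in> B' n"
    using assms(2) unfolding computable_numbering_def by blast
  then obtain l where l: "P1 l" "L = dom l"
    unfolding ce_def by blast
  obtain f where f: "P1 f"
    and F: "\<And>i. i \<in> dom x \<Longrightarrow> \<exists>j. f i = Some j \<and> j \<in> dom x' \<and> F (the (x i)) = the (x' j)"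
    using assms(3) unfolding effective_map_def by blast
  \<comment> \<open>Translate \<open>i\<close> into a number of the image point, then wait for the
    pair to appear in \<open>L\<close>.\<close>
  let ?G = "\<lambda>i n. Option.bind (f i) (\<lambda>j. l (pr j n))"
  have "P2 ?G"
    unfolding P2_iff_precursive
    by (intro precursive_bind precursive_P1[OF f] precursive_P1[OF l(1)] recursive_R2[OF pr]
        recursive_nth recursive_tl) simp_all
  moreover have "?G i n \<noteq> None \<longleftrightarrow> the (x i) \<in> F -` B' n" if i: "i \<in> dom x" for i n
  proof -
    obtain j where j: "f i = Some j" "j \<in> dom x'" "F (the (x i)) = the (x' j)"
      using F[OF i] by blast
    have "?G i n \<noteq> None \<longleftrightarrow> pr j n \<in> L"
      unfolding l(2) by (simp add: j(1) domIff)
    with L[OF j(2)] j(3) show ?thesis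
      by simp
  qed
  ultimately show ?thesis
    unfolding semidecidable_family_def by blast
qed

text \<open>Makes the basic open sets of \<open>X\<close> themselves an instance of
  \<open>semidecidable_vimage\<close>.\<close>

lemma effective_map_id: "effective_map x x id"
  unfolding effective_map_def P1_iff_precursive
  by (intro exI[of _ Some] conjI recursive_nth) auto

lemma topspace_numbered:
  assumes "numbered_T0_space X B x" "x i = Some z"
  shows "z \<in> topspace X"
  using assms unfolding numbered_T0_space_def numbering_def by (auto simp: ran_def)

lemma openin_numbered_basis:
  assumes "numbered_T0_space X B x"
  shows "openin X (B n)"
proof -
  have "openin X = arbitrary union_of (\<lambda>U. U \<in> range B)"
    using assms by (simp add: numbered_T0_space_def)
  then show ?thesis
    by (simp add: arbitrary_union_of_inc)
qed

lemma numbered_basis_subset: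
  assumes "numbered_T0_space X B x" "openin X U" "z \<in> U"
  obtains n where "z \<in> B n" "B n \<subseteq> U"
proof -
  have "(arbitrary union_of (\<lambda>U. U \<in> range B)) U"
    using assms by (simp add: numbered_T0_space_def)
  then obtain \<U> where "\<U> \<subseteq> range B" "\<Union> \<U> = U"
    by (auto simp: union_of_def)
  with assms(3) that show ?thesis
    by blast
qed

lemma Lim_set_offset: "Lim_set X (\<lambda>a. y (a + k)) = Lim_set X y"
  unfolding Lim_set_def
  using limitin_sequentially_offset limitin_sequentially_offset_rev by fastforce

lemma Lim_set_eventually_const:
  assumes "\<And>a. a \<ge> a0 \<Longrightarrow> y a = z" "z \<in> topspace X"
  shows "z \<in> Lim_set X y"
  using assms unfolding Lim_set_def limitin_def eventually_sequentially by auto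

section \<open>Sequences over a space with a limit algorithm and delaying\<close>

locale delaying_limit_space =
  fixes \<phi> :: "nat \<Rightarrow> nat \<rightharpoonup> nat" and X :: "'a topology" and B :: "nat \<Rightarrow> 'a set"
    and prec :: "nat \<Rightarrow> nat \<Rightarrow> bool" and x :: "nat \<rightharpoonup> 'a" and Seq :: "(nat \<Rightarrow> 'a) set"
    and li :: "nat \<rightharpoonup> nat"
  assumes goedel_numbering: "goedel_numbering \<phi>"
    and numbered: "numbered_T0_space X B x"
    and admissible: "admissible_Seq \<phi> X B prec x Seq"
    and limit_algorithm: "limit_algorithm \<phi> X x Seq li"
    and delaying: "\<And>y. y \<in> Seq \<Longrightarrow> allows_delaying Seq y"
begin

abbreviation conv :: "nat \<Rightarrow> (nat \<Rightarrow> 'a) \<Rightarrow> bool" where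
  "conv \<equiv> convergent_Seq_index \<phi> X x Seq"

text \<open>For indices of convergent sequences in \<open>Seq\<close> both uses of
  \<open>the\<close> meet a defined value; for other indices \<open>lim_point\<close> carries no
  information.\<close>

definition lim_point :: "nat \<Rightarrow> 'a" where
  "lim_point m = the (x (the (li m)))"

lemma li_defined: "conv m y \<Longrightarrow> \<exists>i. li m = Some i \<and> i \<in> dom x"
  and lim_point_in_Lim_set: "conv m y \<Longrightarrow> lim_point m \<in> Lim_set X y"
  and lim_point_eventually_const:
    "conv m y \<Longrightarrow> (\<And>a. a \<ge> a0 \<Longrightarrow> y a = y a0) \<Longrightarrow> lim_point m = y a0"
  and lim_point_cong:
    "conv m y \<Longrightarrow> conv m' y' \<Longrightarrow> Lim_set X y = Lim_set X y' \<Longrightarrow> lim_point m = lim_point m'"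
  using limit_algorithm unfolding limit_algorithm_def lim_point_def by blast+

lemma Seq_topspace: "seq_index \<phi> x m y \<Longrightarrow> y a \<in> topspace X"
  unfolding seq_index_def using topspace_numbered[OF numbered] by blast

lemma freeze_in_Seq: "y \<in> Seq \<Longrightarrow> (\<lambda>a. y (min a a0)) \<in> Seq"
proof -
  assume "y \<in> Seq"
  then have "(\<lambda>a. if a < a0 then y a else y a0) \<in> Seq"
    using admissible unfolding admissible_Seq_def by blast
  moreover have "(\<lambda>a. if a < a0 then y a else y a0) = (\<lambda>a. y (min a a0))"
    by auto
  ultimately show ?thesis
    by simp
qed

text \<open>By truncated subtraction, \<open>k < a - a0\<close> means that \<open>a\<close> is past
  \<open>a0 + k\<close>. The first term after the delay is \<open>y (a0 + 2)\<close>, so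
  \<open>y (a0 + 1)\<close> is skipped.\<close>

lemma delay_in_Seq:
  assumes "y \<in> Seq"
  shows "(\<lambda>a. y (if k < a - a0 then a - k + 1 else min a a0)) \<in> Seq"
proof -
  have "(\<lambda>a. if a < a0 then y a else if a \<le> a0 + k then y a0 else y (a - k + 1)) \<in> Seq"
    using delaying[OF assms] unfolding allows_delaying_def by blast
  moreover have "(\<lambda>a. if a < a0 then y a else if a \<le> a0 + k then y a0 else y (a - k + 1))
      = (\<lambda>a. y (if k < a - a0 then a - k + 1 else min a a0))"
    by (rule ext) (auto simp: min_def)
  ultimately show ?thesis
    by simp
qed

lemma seq_index_exists:
  assumes "computable_seq x y"
  shows "\<exists>m. seq_index \<phi> x m y"
proof -
  obtain g where g: "R1 g" "\<And>a. x (g a) = Some (y a)"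
    using assms unfolding computable_seq_def by blast
  then have "(\<lambda>a. Some (g a)) \<in> range \<phi>"
    using goedel_numbering unfolding goedel_numbering_def R1_def by simp
  then obtain m where "\<phi> m = (\<lambda>a. Some (g a))"
    by (metis rangeE)
  with g show ?thesis
    unfolding seq_index_def goedel_number_def by blast
qed

text \<open>An eventually constant sequence may have several limits in a T0 space; the limit
  algorithm is required to select the constant value.\<close>

lemma conv_freeze:
  assumes "seq_index \<phi> x e (\<lambda>a. y (min a a0))" "y \<in> Seq"
  shows "conv e (\<lambda>a. y (min a a0))" "lim_point e = y a0"
proof -
  have "y a0 \<in> topspace X"
    using Seq_topspace[OF assms(1), of a0] by simp
  then have "y a0 \<in> Lim_set X (\<lambda>a. y (min a a0))"
    by (intro Lim_set_eventually_const[of a0]) simp_all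
  then show conv: "conv e (\<lambda>a. y (min a a0))"
    unfolding convergent_Seq_index_def using assms freeze_in_Seq by blast
  show "lim_point e = y a0"
    using lim_point_eventually_const[OF conv, of a0] by simp
qed

text \<open>Computing \<open>li m\<close> and then semideciding membership in \<open>W n\<close> is
  a single partial computation, which can be observed by stages. The self-referential sequences wait
  for its success.\<close>

lemma limit_stages:
  assumes "semidecidable_family x W"
  obtains T where "recursive 3 (\<lambda>xs. T (xs ! 0) (xs ! 1) (xs ! 2))"
    and "\<And>m y n. conv m y \<Longrightarrow> (\<exists>k. T m n k \<noteq> 0) \<longleftrightarrow> lim_point m \<in> W n"
proof -
  obtain G where G: "P2 G" "\<And>i n. i \<in> dom x \<Longrightarrow> G i n \<noteq> None \<longleftrightarrow> the (x i) \<in> W n"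
    using assms unfolding semidecidable_family_def by blast
  have li: "P1 li"
    using limit_algorithm unfolding limit_algorithm_def by blast
  have "P2 (\<lambda>m n. Option.bind (li m) (\<lambda>i. G i n))"
    unfolding P2_iff_precursive
    by (intro precursive_bind precursive_P1[OF li] precursive_P2[OF G(1)] recursive_nth recursive_tl)
      simp_all
  then obtain T where T: "recursive 3 (\<lambda>xs. T (xs ! 0) (xs ! 1) (xs ! 2))"
    "\<And>m n. (\<exists>k. T m n k \<noteq> 0) \<longleftrightarrow> Option.bind (li m) (\<lambda>i. G i n) \<noteq> None"
    using P2_stages by blast
  show ?thesis
  proof
    fix m y n
    assume "conv m y"
    then obtain i where "li m = Some i" "i \<in> dom x"
      using li_defined by blast
    with G(2) show "(\<exists>k. T m n k \<noteq> 0) \<longleftrightarrow> lim_point m \<in> W n"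
      unfolding T(2) lim_point_def by simp
  qed (rule T(1))
qed

lemma lim_point_in_if_member:
  assumes W: "semidecidable_family x W" and conv: "conv m y" and y: "y a0 \<in> W n"
  shows "lim_point m \<in> W n"
proof -
  obtain T where T: "recursive 3 (\<lambda>xs. T (xs ! 0) (xs ! 1) (xs ! 2))"
    and lim: "\<And>m y n. conv m y \<Longrightarrow> (\<exists>k. T m n k \<noteq> 0) \<longleftrightarrow> lim_point m \<in> W n"
    using limit_stages[OF W] by blast
  obtain g where g: "R1 g" "\<And>a. x (g a) = Some (y a)"
    using conv unfolding convergent_Seq_index_def seq_index_def goedel_number_def by blast
  have Seq: "y \<in> Seq"
    using conv unfolding convergent_Seq_index_def by blast
  \<comment> \<open>\<open>h e a\<close> counts the failed stages among the \<open>a - a0\<close>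
    checked so far. If it is smaller than \<open>a - a0\<close>, success was observed, and
    \<open>d\<close> resumes \<open>y\<close> with the shift of \<open>delay_in_Seq\<close>.\<close>
  define h where "h e a = first_stage (T e n) (a - a0)" for e a
  define d where "d e a = (if h e a < a - a0 then Suc (a - h e a) else min a a0)" for e a
  note intros = recursive_if_less recursive_first_stage[OF T] recursive_diff recursive_Suc
    recursive_min recursive_const recursive_nth
  have "recursive 2 (\<lambda>xs. d (xs ! 0) (xs ! 1))"
    unfolding d_def h_def by (intro intros) simp_all
  then have rec_d: "R2 d"
    by (simp add: R2_iff_recursive)
  have "precursive 3 (\<lambda>xs. Some (g (d (xs ! 1) (xs ! 2))))"
    by (intro recursive_R1[OF g(1)] recursive_R2[OF rec_d] recursive_nth) simp_all
  then obtain e0 :: "nat \<Rightarrow> nat" where "\<And>p. \<phi> (e0 p) = (\<lambda>a. Some (g (d (e0 p) a)))"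
    using recursion_theorem[OF goedel_numbering, of "\<lambda>p e a. Some (g (d e a))"] by blast
  then obtain e where e: "\<phi> e = (\<lambda>a. Some (g (d e a)))"
    by blast
  have "R1 (\<lambda>a. g (d e a))"
    unfolding R1_iff_recursive
    by (intro recursive_R1[OF g(1)] recursive_R2[OF rec_d] recursive_nth recursive_const) simp
  then have idx: "seq_index \<phi> x e (\<lambda>a. y (d e a))"
    unfolding seq_index_def goedel_number_def using e g(2) by blast
  show ?thesis
  proof (cases "\<exists>k. T e n k \<noteq> 0")
    case True
    define l where "l = (LEAST k. T e n k \<noteq> 0)"
    have "h e a = min (a - a0) l" for a
      unfolding h_def first_stage_eq l_def using True by (rule if_P)
    then have "d e a = (if l < a - a0 then a - l + 1 else min a a0)" for a
      unfolding d_def by auto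
    then have d: "(\<lambda>a. y (d e a)) = (\<lambda>a. y (if l < a - a0 then a - l + 1 else min a a0))"
      by simp
    \<comment> \<open>Here \<open>(a + a0 + l + 1) - l + 1 = a + a0 + 2\<close>, so the delayed and
      the original sequence share a tail and hence all limits.\<close>
    have "(\<lambda>a. y (d e (a + Suc (a0 + l)))) = (\<lambda>a. y (a + Suc (Suc a0)))"
      unfolding d[THEN fun_cong] by (simp add: algebra_simps)
    then have Lim: "Lim_set X (\<lambda>a. y (d e a)) = Lim_set X y"
      using Lim_set_offset[of X "\<lambda>a. y (d e a)" "Suc (a0 + l)"] Lim_set_offset[of X y "Suc (Suc a0)"]
      by simp
    have "(\<lambda>a. y (d e a)) \<in> Seq"
      unfolding d using Seq by (rule delay_in_Seq)
    with idx Lim conv have conv_e: "conv e (\<lambda>a. y (d e a))"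
      unfolding convergent_Seq_index_def by simp
    then have "lim_point e \<in> W n"
      using lim True by blast
    with lim_point_cong[OF conv_e conv Lim] show ?thesis
      by simp
  next
    \<comment> \<open>Without success the sequence stays at \<open>y a0\<close>, so its limit point
      \<open>y a0\<close> is in \<open>W n\<close> and success would be observed after all.\<close>
    case False
    then have "d e a = min a a0" for a
      unfolding d_def h_def first_stage_eq by simp
    with idx have idx: "seq_index \<phi> x e (\<lambda>a. y (min a a0))"
      by simp
    with lim[OF conv_freeze(1)[OF idx Seq]] conv_freeze(2)[OF idx Seq] False y show ?thesis
      by simp
  qed
qed

lemma freeze_algorithm:
  assumes W: "semidecidable_family x W"
  obtains k where "R1 k"
    and "\<And>m y n. conv m y \<Longrightarrow> lim_point m \<in> W n \<Longrightarrow> \<exists>t. \<phi> (k m) n = Some t \<and> y t \<in> W n"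
proof -
  obtain T where T: "recursive 3 (\<lambda>xs. T (xs ! 0) (xs ! 1) (xs ! 2))"
    and lim: "\<And>m y n. conv m y \<Longrightarrow> (\<exists>k. T m n k \<noteq> 0) \<longleftrightarrow> lim_point m \<in> W n"
    using limit_stages[OF W] by blast
  have P2: "P2 \<phi>" and smn: "\<And>g. P2 g \<Longrightarrow> \<exists>s. R1 s \<and> (\<forall>i. \<phi> (s i) = g i)"
    using goedel_numbering unfolding goedel_numbering_def by blast+
  \<comment> \<open>\<open>p\<close> codes \<open>(m, n)\<close>. The program \<open>e\<close>
    copies \<open>\<phi> m\<close> but stops advancing once \<open>T\<close> reports that its own
    limit point is in \<open>W n\<close>.\<close>
  let ?H = "\<lambda>p e a. \<phi> (fst (prod_decode p)) (first_stage (T e (snd (prod_decode p))) a)"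
  have "precursive 3 (\<lambda>xs. ?H (xs ! 0) (xs ! 1) (xs ! 2))"
    by (intro precursive_P2[OF P2] recursive_first_stage[OF T] recursive_prod_decode recursive_nth)
      simp_all
  then obtain e where e: "R1 e" "\<And>p. \<phi> (e p) = ?H p (e p)"
    using recursion_theorem[OF goedel_numbering, of ?H] by blast
  let ?e = "\<lambda>m n. e (prod_encode (m, n))"
  \<comment> \<open>Zero marks success, since minimization searches for zeros.\<close>
  let ?p = "\<lambda>m n t. if T (?e m n) n t = 0 then 1 else (0::nat)"
  let ?K = "\<lambda>m n. if \<exists>t. ?p m n t = 0 then Some (LEAST t. ?p m n t = 0) else None"
  have "P2 ?K"
    unfolding P2_iff_precursive
    by (intro precursive_Least recursive_if recursive_const precursive_compose3[OF T]
        recursive_R1[OF e(1)] recursive_prod_encode recursive_nth recursive_tl) simp_all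
  then obtain k where k: "R1 k" "\<And>m. \<phi> (k m) = ?K m"
    using smn by blast
  have "\<exists>t. \<phi> (k m) n = Some t \<and> y t \<in> W n" if conv: "conv m y" and W: "lim_point m \<in> W n" for m y n
  proof -
    obtain g where g: "R1 g" "\<phi> m = (\<lambda>a. Some (g a))" "\<And>a. x (g a) = Some (y a)"
      using conv unfolding convergent_Seq_index_def seq_index_def goedel_number_def by blast
    have Seq: "y \<in> Seq"
      using conv unfolding convergent_Seq_index_def by blast
    let ?h = "first_stage (T (?e m n) n)"
    have \<phi>e: "\<phi> (?e m n) = (\<lambda>a. Some (g (?h a)))"
      using e(2)[of "prod_encode (m, n)"] by (simp add: g(2))
    have "R1 (\<lambda>a. g (?h a))"
      unfolding R1_iff_recursive
      by (intro recursive_R1[OF g(1)] recursive_first_stage[OF T] recursive_nth recursive_const) simp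
    then have idx: "seq_index \<phi> x (?e m n) (\<lambda>a. y (?h a))"
      unfolding seq_index_def goedel_number_def using \<phi>e g(3) by blast
    show ?thesis
    proof (cases "\<exists>t. T (?e m n) n t \<noteq> 0")
      case True
      define l where "l = (LEAST t. T (?e m n) n t \<noteq> 0)"
      have "?h a = min a l" for a
        unfolding first_stage_eq using True by (simp add: l_def)
      with idx have idx: "seq_index \<phi> x (?e m n) (\<lambda>a. y (min a l))"
        by simp
      \<comment> \<open>The sequence frozen at \<open>l\<close> has limit point \<open>y l\<close>,
        and the observed success places this point in \<open>W n\<close>.\<close>
      have "y l \<in> W n"
        using lim[OF conv_freeze(1)[OF idx Seq]] conv_freeze(2)[OF idx Seq] True by simp
      moreover have "?p m n t = 0 \<longleftrightarrow> T (?e m n) n t \<noteq> 0" for t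
        by simp
      then have "\<phi> (k m) n = Some l"
        unfolding k(2) l_def using True by simp
      ultimately show ?thesis
        by blast
    next
      \<comment> \<open>Never frozen, the sequence is \<open>y\<close> itself. Its limit point is
        that of \<open>m\<close>, hence in \<open>W n\<close>, so success must occur.\<close>
      case False
      then have "?h a = a" for a
        unfolding first_stage_eq by simp
      with idx conv have conv_e: "conv (?e m n) y"
        unfolding convergent_Seq_index_def by simp
      have "lim_point (?e m n) = lim_point m"
        using lim_point_cong[OF conv_e conv] by simp
      with lim[OF conv_e] W False show ?thesis
        by simp
    qed
  qed
  with k(1) show ?thesis
    by (rule that)
qed

text \<open>Truncated at \<open>c\<close>, the sequence converges with limit point
  \<open>y c\<close>, so \<open>lim_point_in_if_member\<close> applies even if \<open>y\<close>
  diverges.\<close>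

lemma semidecidable_monotone_along_Seq:
  assumes W: "semidecidable_family x W" and "y \<in> Seq" "a \<le> c" "y a \<in> W n"
  shows "y c \<in> W n"
proof -
  have "computable_seq x (\<lambda>a. y (min a c))"
    using freeze_in_Seq[OF assms(2)] admissible unfolding admissible_Seq_def by blast
  then obtain e where e: "seq_index \<phi> x e (\<lambda>a. y (min a c))"
    using seq_index_exists by blast
  have "lim_point e \<in> W n"
    using assms(3,4) by (intro lim_point_in_if_member[OF W conv_freeze(1)[OF e assms(2)], of a]) simp
  then show ?thesis
    by (simp add: conv_freeze(2)[OF e assms(2)])
qed

text \<open>The sequence \<open>w, z, z, ...\<close> is monotone, so it belongs to
  \<open>Seq\<close>. For preimages of basic open sets under \<open>F\<close>, the result is
  monotonicity of \<open>F\<close> in the specialization orders.\<close>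

lemma semidecidable_spec_le:
  assumes W: "semidecidable_family x W" and le: "spec_le B w z"
    and "w \<in> topspace X" "z \<in> topspace X" "w \<in> W n"
  shows "z \<in> W n"
proof -
  let ?s = "\<lambda>a::nat. if a = 0 then w else z"
  obtain i j where ij: "x i = Some w" "x j = Some z"
    using assms(3,4) numbered unfolding numbered_T0_space_def numbering_def ran_def by blast
  have "R1 (\<lambda>a. if a = 0 then i else j)"
    unfolding R1_iff_recursive by (intro recursive_if recursive_nth recursive_const) simp
  with ij have "computable_seq x ?s"
    unfolding computable_seq_def by (intro exI[of _ "\<lambda>a. if a = 0 then i else j"]) simp
  moreover have "monotone (\<le>) (spec_le B) ?s"
    using le by (auto simp: monotone_def spec_le_def)
  ultimately have "?s \<in> Seq"
    using admissible unfolding admissible_Seq_def by blast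
  from semidecidable_monotone_along_Seq[OF W this, of 0 1 n] assms(5) show ?thesis
    by simp
qed

text \<open>A basic open set around a limit contains a term of the sequence, hence also the limit
  point. Being a limit itself, the limit point is the greatest one.\<close>

lemma Lim_set_le_lim_point:
  assumes "semidecidable_family x B" "conv m y" "w \<in> Lim_set X y"
  shows "spec_le B w (lim_point m)"
  unfolding spec_le_def
proof (intro allI impI)
  fix n assume "w \<in> B n"
  with assms(3) openin_numbered_basis[OF numbered] have "\<forall>\<^sub>F a in sequentially. y a \<in> B n"
    by (auto simp: Lim_set_def limitin_def)
  then obtain a where "y a \<in> B n"
    using eventually_happens by force
  then show "lim_point m \<in> B n"
    by (rule lim_point_in_if_member[OF assms(1,2)])
qed

end

theorem theorem7p1:
  fixes \<phi> :: "nat \<Rightarrow> nat \<rightharpoonup> nat"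
    and pr :: "nat \<Rightarrow> nat \<Rightarrow> nat"
    and X :: "'a topology" and B :: "nat \<Rightarrow> 'a set" and x :: "nat \<rightharpoonup> 'a"
    and prec :: "nat \<Rightarrow> nat \<Rightarrow> bool"
    and X' :: "'b topology" and B' :: "nat \<Rightarrow> 'b set" and x' :: "nat \<rightharpoonup> 'b"
    and Seq :: "(nat \<Rightarrow> 'a) set"
    and F :: "'a \<Rightarrow> 'b"
  assumes "goedel_numbering \<phi>" and "computable_pairing pr"
    and "numbered_T0_space X B x" and "strong_inclusion B prec"
    and "numbered_T0_space X' B' x'"
    and "admissible_Seq \<phi> X B prec x Seq"
    and "computable_numbering pr B x" and "has_limit_algorithm \<phi> X x Seq"
    and "computable_numbering pr B' x'"
    and "\<forall>y\<in>Seq. allows_delaying Seq y"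
    and "F \<in> topspace X \<rightarrow> topspace X'" and "effective_map x x' F"
  shows "strongly_eff_seq_continuous \<phi> X x Seq X' B' F"
proof -
  obtain li where "limit_algorithm \<phi> X x Seq li"
    using assms(8) unfolding has_limit_algorithm_def by blast
  then interpret delaying_limit_space \<phi> X B prec x Seq li
    using assms by unfold_locales auto
  let ?W = "\<lambda>n. F -` B' n"
  have W: "semidecidable_family x ?W"
    using assms(2,9,12) by (rule semidecidable_vimage)
  have B: "semidecidable_family x B"
    using semidecidable_vimage[OF assms(2,7) effective_map_id] by simp
  obtain k where k: "R1 k"
    "\<And>m y n. conv m y \<Longrightarrow> lim_point m \<in> ?W n \<Longrightarrow> \<exists>t. \<phi> (k m) n = Some t \<and> y t \<in> ?W n"
    using freeze_algorithm[OF W] by blast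
  \<comment> \<open>One term in the preimage suffices, since membership persists along sequences in
    \<open>Seq\<close>.\<close>
  have k': "\<exists>N. \<phi> (k m) n = Some N \<and> (\<forall>c\<ge>N. F (y c) \<in> B' n)"
    if "conv m y" "lim_point m \<in> ?W n" for m y n
  proof -
    have "y \<in> Seq"
      using that(1) unfolding convergent_Seq_index_def by blast
    then have "y c \<in> ?W n" if "t \<le> c" "y t \<in> ?W n" for t c
      using that by (rule semidecidable_monotone_along_Seq[OF W])
    with k(2)[OF that] show ?thesis
      by (metis vimageE)
  qed
  have "F w \<in> Lim_set X' (\<lambda>a. F (y a))" if conv: "conv m y" and w: "w \<in> Lim_set X y" for m y w
  proof -
    have top: "w \<in> topspace X" "lim_point m \<in> topspace X"
      using w lim_point_in_Lim_set[OF conv] by (auto simp: Lim_set_def limitin_def)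
    have "\<forall>\<^sub>F a in sequentially. F (y a) \<in> U" if U: "openin X' U" "F w \<in> U" for U
    proof -
      obtain n where n: "F w \<in> B' n" "B' n \<subseteq> U"
        using numbered_basis_subset[OF assms(5) U] .
      \<comment> \<open>\<open>w\<close> lies below the limit point, so membership passes from
        \<open>w\<close> to it.\<close>
      have "lim_point m \<in> ?W n"
        using semidecidable_spec_le[OF W Lim_set_le_lim_point[OF B conv w] top] n(1) by blast
      with k'[OF conv] n(2) show ?thesis
        unfolding eventually_sequentially by blast
    qed
    moreover have "F w \<in> topspace X'"
      using assms(11) top(1) by blast
    ultimately show ?thesis
      by (simp add: Lim_set_def limitin_def)
  qed
  moreover have "uniform_convergence_module X' B' (\<lambda>a. F (y a)) (\<phi> (k m))" if conv: "conv m y" for m y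
    unfolding uniform_convergence_module_def
  proof (intro allI impI)
    \<comment> \<open>The limit \<open>v\<close> need not be the image of a limit of
      \<open>y\<close>; it only serves to find a term of the image sequence in
      \<open>B' n\<close>.\<close>
    fix n assume "B' n \<inter> Lim_set X' (\<lambda>a. F (y a)) \<noteq> {}"
    then obtain v where "v \<in> B' n" "limitin X' (\<lambda>a. F (y a)) v sequentially"
      by (auto simp: Lim_set_def)
    then have "\<forall>\<^sub>F a in sequentially. F (y a) \<in> B' n"
      using openin_numbered_basis[OF assms(5)] unfolding limitin_def by blast
    then obtain a where "F (y a) \<in> B' n"
      using eventually_happens by force
    then have "lim_point m \<in> ?W n"
      by (intro lim_point_in_if_member[OF W conv, of a]) simp
    then show "\<exists>N. \<phi> (k m) n = Some N \<and> (\<forall>c\<ge>N. F (y c) \<in> B' n)"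
      by (rule k'[OF conv])
  qed
  ultimately show ?thesis
    unfolding strongly_eff_seq_continuous_def using k(1) by blast
qed

end
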